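(* Let $c:\mathbb{X}\times\mathbb{U}\to\mathbb{R}$ be a non-negative, measurable and bounded function, let $P_n,P\in\mathcal{P}(\mathbb{X})$, and let $\gamma^*_{P_n}\in\Gamma$ be an optimal policy for prior $P_n$, i.e. $J_\beta(P_n,Q,\gamma^*_{P_n})=J_\beta^*(P_n,Q)$. Then $$|J_\beta(P,Q,\gamma^*_{P_n})-J_\beta^*(P,Q)|\le2\,\|P_n-P\|_{TV}\,\frac{1}{1-\beta}\,\|c\|_\infty .$$
   Context: $\mathbb{X}\subset\mathbb{R}^n$, $\mathbb{Y}\subset\mathbb{R}^m$ and $\mathbb{U}$ (a subset of some Euclidean space) are Borel sets; $\mathcal{P}(\mathbb{X})$ is the set of Borel probability measures on $\mathbb{X}$. $Q(\cdot|x)$ (the channel) is a stochastic kernel from $\mathbb{X}$ to $\mathbb{Y}$ and $\mathcal{T}(\cdot|x,u)$ is a stochastic kernel from $\mathbb{X}\times\mathbb{U}$ to $\mathbb{X}$. An admissible policy is a sequence $\gamma=\{\gamma_t\}_{t\ge0}$ of measurable control functions with $U_t=\gamma_t(I_t)\in\mathbb{U}$, where $I_0=\{Y_0\}$, $I_t=\{Y_0,\dots,Y_t,U_0,\dots,U_{t-1}\}$; $\Gamma$ is the set of admissible policies. Given an initial law (prior) $P\in\mathcal{P}(\mathbb{X})$ and $\gamma\in\Gamma$, the process evolves as $X_0\sim P$, $Y_t\sim Q(\cdot|X_t)$ and $X_{t+1}\sim\mathcal{T}(\cdot|X_t,U_t)$ (conditionally on the past); $E_P^{Q,\gamma}$ is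 the corresponding expectation. For fixed $\beta\in(0,1)$ and fixed $\mathcal{T}$, $$J_\beta(P,Q,\gamma)=E_P^{Q,\gamma}\Big[\sum_{t=0}^\infty\beta^tc(X_t,U_t)\Big],\qquad J_\beta^*(P,Q)=\inf_{\gamma\in\Gamma}J_\beta(P,Q,\gamma).$$ $\|c\|_\infty$ is the supremum norm, and $\|\mu-\nu\|_{TV}=2\sup_B|\mu(B)-\nu(B)|$ over Borel sets $B$. *)

theory Defs
  imports "HOL-Probability.Probability"
begin

abbreviation borel_on :: "'a::topological_space set \<Rightarrow> 'a measure" where
  "borel_on S \<equiv> restrict_space borel S"

text \<open>
  The Borel probability measures on \<open>S\<close>. A stochastic kernel from \<open>A\<close> to \<open>S\<close> is correspondingly
  an element of \<open>A \<rightarrow>\<^sub>M prob_algebra (borel_on S)\<close>.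
\<close>

abbreviation prob_measures :: "'a::topological_space set \<Rightarrow> 'a measure set" where
  "prob_measures S \<equiv> space (prob_algebra (borel_on S))"

text \<open>
  The control function at time \<open>t\<close> maps \<open>((Y\<^sub>0, \<dots>, Y\<^sub>t), (U\<^sub>0, \<dots>, U\<^sub>t\<^sub>-\<^sub>1))\<close> to \<open>U\<^sub>t\<close>. Histories are
  extensional functions on \<open>{..t}\<close> and \<open>{..<t}\<close>.
\<close>

type_synonym ('y, 'u) policy = "nat \<Rightarrow> (nat \<Rightarrow> 'y) \<times> (nat \<Rightarrow> 'u) \<Rightarrow> 'u"

definition info_space :: "'y::topological_space set \<Rightarrow> 'u::topological_space set \<Rightarrow> nat
    \<Rightarrow> ((nat \<Rightarrow> 'y) \<times> (nat \<Rightarrow> 'u)) measure" where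
  "info_space Y U t = PiM {..t} (\<lambda>_. borel_on Y) \<Otimes>\<^sub>M PiM {..<t} (\<lambda>_. borel_on U)"

definition policies :: "'y::topological_space set \<Rightarrow> 'u::topological_space set
    \<Rightarrow> ('y, 'u) policy set" where
  "policies Y U = {\<gamma>. \<forall>t. \<gamma> t \<in> info_space Y U t \<rightarrow>\<^sub>M borel_on U}"

text \<open>
  \<open>(X\<^sub>t, Y\<^sub>t, U\<^sub>t)\<close> takes values in \<open>stage_space X Y U\<close>; \<open>stage_kernel\<close> is its conditional law given
  the earlier stages \<open>h = (X\<^sub>i, Y\<^sub>i, U\<^sub>i)\<^sub>i\<^sub><\<^sub>t\<close>.
\<close>

definition stage_space :: "'x::topological_space set \<Rightarrow> 'y::topological_space set
    \<Rightarrow> 'u::topological_space set \<Rightarrow> ('x \<times> 'y \<times> 'u) measure" where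
  "stage_space X Y U = borel_on X \<Otimes>\<^sub>M (borel_on Y \<Otimes>\<^sub>M borel_on U)"

definition info :: "nat \<Rightarrow> (nat \<Rightarrow> 'x \<times> 'y \<times> 'u) \<Rightarrow> 'y \<Rightarrow> (nat \<Rightarrow> 'y) \<times> (nat \<Rightarrow> 'u)" where
  "info t h y =
    (\<lambda>i\<in>{..t}. if i = t then y else fst (snd (h i)), \<lambda>i\<in>{..<t}. snd (snd (h i)))"

definition state_kernel :: "'x measure \<Rightarrow> ('x \<times> 'u \<Rightarrow> 'x measure)
    \<Rightarrow> nat \<Rightarrow> (nat \<Rightarrow> 'x \<times> 'y \<times> 'u) \<Rightarrow> 'x measure" where
  "state_kernel P T t h =
    (case t of 0 \<Rightarrow> P | Suc s \<Rightarrow> T (fst (h s), snd (snd (h s))))"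

definition stage_kernel :: "'x::topological_space set \<Rightarrow> 'y::topological_space set
    \<Rightarrow> 'u::topological_space set \<Rightarrow> ('x \<times> 'u \<Rightarrow> 'x measure) \<Rightarrow> 'x measure
    \<Rightarrow> ('x \<Rightarrow> 'y measure) \<Rightarrow> ('y, 'u) policy
    \<Rightarrow> nat \<Rightarrow> (nat \<Rightarrow> 'x \<times> 'y \<times> 'u) \<Rightarrow> ('x \<times> 'y \<times> 'u) measure" where
  "stage_kernel X Y U T P Q \<gamma> t h =
    state_kernel P T t h \<bind> (\<lambda>x. Q x \<bind> (\<lambda>y.
      return (stage_space X Y U) (x, y, \<gamma> t (info t h y))))"

text \<open>
  The law of \<open>(X\<^sub>t, Y\<^sub>t, U\<^sub>t)\<^sub>t\<^sub>\<ge>\<^sub>0\<close> on the infinite product, i.e. the measure obtained from the stage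
  kernels by the Ionescu-Tulcea theorem.
\<close>

definition process_law :: "'x::topological_space set \<Rightarrow> 'y::topological_space set
    \<Rightarrow> 'u::topological_space set \<Rightarrow> ('x \<times> 'u \<Rightarrow> 'x measure) \<Rightarrow> 'x measure
    \<Rightarrow> ('x \<Rightarrow> 'y measure) \<Rightarrow> ('y, 'u) policy
    \<Rightarrow> (nat \<Rightarrow> 'x \<times> 'y \<times> 'u) measure" where
  "process_law X Y U T P Q \<gamma> =
    projective_family.lim UNIV
      (Ionescu_Tulcea.CI (stage_kernel X Y U T P Q \<gamma>) (\<lambda>_. stage_space X Y U))
      (\<lambda>_. stage_space X Y U)"

definition J :: "'x::topological_space set \<Rightarrow> 'y::topological_space set
    \<Rightarrow> 'u::topological_space set \<Rightarrow> ('x \<times> 'u \<Rightarrow> 'x measure) \<Rightarrow> ('x \<times> 'u \<Rightarrow> real) \<Rightarrow> real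
    \<Rightarrow> 'x measure \<Rightarrow> ('x \<Rightarrow> 'y measure) \<Rightarrow> ('y, 'u) policy \<Rightarrow> real" where
  "J X Y U T c \<beta> P Q \<gamma> =
    (\<integral>\<omega>. (\<Sum>t. \<beta> ^ t * c (fst (\<omega> t), snd (snd (\<omega> t)))) \<partial>process_law X Y U T P Q \<gamma>)"

definition J_opt :: "'x::topological_space set \<Rightarrow> 'y::topological_space set
    \<Rightarrow> 'u::topological_space set \<Rightarrow> ('x \<times> 'u \<Rightarrow> 'x measure) \<Rightarrow> ('x \<times> 'u \<Rightarrow> real) \<Rightarrow> real
    \<Rightarrow> 'x measure \<Rightarrow> ('x \<Rightarrow> 'y measure) \<Rightarrow> real" where
  "J_opt X Y U T c \<beta> P Q = (INF \<gamma>\<in>policies Y U. J X Y U T c \<beta> P Q \<gamma>)"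

definition tv_dist :: "'a measure \<Rightarrow> 'a measure \<Rightarrow> real" where
  "tv_dist \<mu> \<nu> = 2 * (SUP B\<in>sets \<mu>. \<bar>measure \<mu> B - measure \<nu> B\<bar>)"

definition sup_norm_on :: "'a set \<Rightarrow> ('a \<Rightarrow> real) \<Rightarrow> real" where
  "sup_norm_on S f = (SUP z\<in>S. \<bar>f z\<bar>)"

text \<open>The hypotheses of the Ionescu-Tulcea theorem hold, so \<open>process_law\<close> is meaningful.\<close>

lemma measurable_info:
  assumes t: "h \<in> N \<rightarrow>\<^sub>M PiM {0..<t} (\<lambda>_. stage_space X Y U)" and y: "f \<in> N \<rightarrow>\<^sub>M borel_on Y"
  shows "(\<lambda>z. info t (h z) (f z)) \<in> N \<rightarrow>\<^sub>M info_space Y U t"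
proof -
  have h: "(\<lambda>z. h z i) \<in> N \<rightarrow>\<^sub>M borel_on X \<Otimes>\<^sub>M (borel_on Y \<Otimes>\<^sub>M borel_on U)" if "i < t" for i
    using measurable_compose[OF t measurable_component_singleton[of i "{0..<t}"]] that
    by (simp add: stage_space_def)
  show ?thesis
    unfolding info_def info_space_def
  proof (intro measurable_Pair measurable_restrict)
    fix i assume "i \<in> {..t}"
    then show "(\<lambda>z. if i = t then f z else fst (snd (h z i))) \<in> N \<rightarrow>\<^sub>M borel_on Y"
      using y h[of i] by (cases "i = t") auto
  next
    fix i assume "i \<in> {..<t}"
    then show "(\<lambda>z. snd (snd (h z i))) \<in> N \<rightarrow>\<^sub>M borel_on U"
      using h[of i] by auto
  qed
qed

lemma Ionescu_Tulcea_stage_kernel: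
  assumes P: "P \<in> prob_measures X"
    and Q: "Q \<in> borel_on X \<rightarrow>\<^sub>M prob_algebra (borel_on Y)"
    and T: "T \<in> borel_on X \<Otimes>\<^sub>M borel_on U \<rightarrow>\<^sub>M prob_algebra (borel_on X)"
    and \<gamma>: "\<gamma> \<in> policies Y U"
  shows "Ionescu_Tulcea (stage_kernel X Y U T P Q \<gamma>) (\<lambda>_. stage_space X Y U)"
proof -
  let ?H = "\<lambda>t. PiM {0..<t} (\<lambda>_. stage_space X Y U)"
  have state: "state_kernel P T t \<in> ?H t \<rightarrow>\<^sub>M prob_algebra (borel_on X)" for t
  proof (cases t)
    case 0
    then show ?thesis using P by (simp add: state_kernel_def[abs_def])
  next
    case (Suc s)
    have "(\<lambda>h. h s) \<in> ?H t \<rightarrow>\<^sub>M borel_on X \<Otimes>\<^sub>M (borel_on Y \<Otimes>\<^sub>M borel_on U)"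
      using measurable_component_singleton[of s "{0..<t}" "\<lambda>_. stage_space X Y U"] Suc
      by (simp add: stage_space_def)
    then have "(\<lambda>h. (fst (h s), snd (snd (h s)))) \<in> ?H t \<rightarrow>\<^sub>M borel_on X \<Otimes>\<^sub>M borel_on U"
      by auto
    from measurable_compose[OF this T] show ?thesis
      by (simp add: state_kernel_def[abs_def] Suc)
  qed
  have K: "stage_kernel X Y U T P Q \<gamma> t \<in> ?H t \<rightarrow>\<^sub>M prob_algebra (stage_space X Y U)" for t
  proof -
    have g: "\<gamma> t \<in> info_space Y U t \<rightarrow>\<^sub>M borel_on U"
      using \<gamma> by (simp add: policies_def)
    have "(\<lambda>z. \<gamma> t (info t (fst (fst z)) (snd z)))
        \<in> (?H t \<Otimes>\<^sub>M borel_on X) \<Otimes>\<^sub>M borel_on Y \<rightarrow>\<^sub>M borel_on U"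
      by (rule measurable_compose[OF measurable_info[where X = X] g]) measurable
    then have "(\<lambda>z. (snd (fst z), snd z, \<gamma> t (info t (fst (fst z)) (snd z))))
        \<in> (?H t \<Otimes>\<^sub>M borel_on X) \<Otimes>\<^sub>M borel_on Y \<rightarrow>\<^sub>M stage_space X Y U"
      unfolding stage_space_def by measurable
    then have r: "(\<lambda>(p, y). return (stage_space X Y U) (snd p, y, \<gamma> t (info t (fst p) y)))
        \<in> (?H t \<Otimes>\<^sub>M borel_on X) \<Otimes>\<^sub>M borel_on Y \<rightarrow>\<^sub>M prob_algebra (stage_space X Y U)"
      using measurable_compose[OF _ measurable_return_prob_space] by (simp add: case_prod_beta')
    have "(\<lambda>p. Q (snd p)) \<in> ?H t \<Otimes>\<^sub>M borel_on X \<rightarrow>\<^sub>M prob_algebra (borel_on Y)"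
      by (rule measurable_compose[OF measurable_snd Q])
    from measurable_bind_prob_space2[OF this r]
    have "(\<lambda>(h, x). Q x \<bind> (\<lambda>y. return (stage_space X Y U) (x, y, \<gamma> t (info t h y))))
        \<in> ?H t \<Otimes>\<^sub>M borel_on X \<rightarrow>\<^sub>M prob_algebra (stage_space X Y U)"
      by (simp add: case_prod_beta')
    from measurable_bind_prob_space2[OF state this] show ?thesis
      by (simp add: stage_kernel_def[abs_def])
  qed
  show ?thesis
  proof (rule Ionescu_Tulcea.intro)
    show "stage_kernel X Y U T P Q \<gamma> t \<in> ?H t \<rightarrow>\<^sub>M subprob_algebra (stage_space X Y U)" for t
      by (rule measurable_prob_algebraD[OF K])
    show "prob_space (stage_kernel X Y U T P Q \<gamma> t h)" if "h \<in> space (?H t)" for t h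
      using measurable_space[OF K that] by (simp add: space_prob_algebra)
  qed
qed

end

theory Submission
  imports Defs
begin

text \<open>
  For a fixed policy the law of the process is a mixture over the initial state whose components
  do not depend on the prior, so each stage cost has expectation \<open>\<integral> \<phi> dP\<close> with
  \<open>0 \<le> \<phi> \<le> \<parallel>c\<parallel>\<^sub>\<infinity>\<close> independent of \<open>P\<close>. The Hahn decomposition bounds
  the difference of two such integrals by \<open>\<parallel>c\<parallel>\<^sub>\<infinity>\<close> times half the total variation
  distance, and summing the geometric series gives
  \<open>\<bar>J(P\<^sub>n, \<gamma>) - J(P, \<gamma>)\<bar> \<le> e\<close> for every policy, with
  \<open>e = \<parallel>c\<parallel>\<^sub>\<infinity> \<parallel>P\<^sub>n - P\<parallel> / (2 (1 - \<beta>))\<close>. Passing from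
  \<open>P\<close> to \<open>P\<^sub>n\<close> and back then costs at most \<open>2e\<close>.
\<close>

section \<open>Total variation and integrals of bounded functions\<close>

text \<open>Domination on the subsets of \<open>A\<close> orders the two measures with density
  \<open>indicator A\<close>, and nonnegative integrals are monotone in the measure. The bound
  \<open>b\<close> gives integrability, which carries the inequality over to Bochner
  integrals.\<close>

lemma integral_indicator_mono_measure:
  fixes f :: "'a \<Rightarrow> real"
  assumes "finite_measure M" "finite_measure N" and sets_eq: "sets N = sets M"
    and A: "A \<in> sets M" and le: "\<And>B. B \<in> sets M \<Longrightarrow> B \<subseteq> A \<Longrightarrow> emeasure M B \<le> emeasure N B"
    and f[measurable]: "f \<in> borel_measurable M"
    and bnd: "\<And>x. x \<in> space M \<Longrightarrow> 0 \<le> f x" "\<And>x. x \<in> space M \<Longrightarrow> f x \<le> b"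
  shows "(\<integral>x. indicator A x * f x \<partial>M) \<le> (\<integral>x. indicator A x * f x \<partial>N)"
proof -
  interpret M: finite_measure M by fact
  interpret N: finite_measure N by fact
  note [measurable_cong] = sets_eq
  note [measurable] = A
  have space_eq: "space N = space M" by (rule sets_eq_imp_space_eq[OF sets_eq])
  have "density M (indicator A) \<le> density N (indicator A)"
    unfolding le_measure_iff
  proof (simp add: space_eq sets_eq, rule le_funI)
    fix B show "emeasure (density M (indicator A)) B \<le> emeasure (density N (indicator A)) B"
    \<comment> \<open>The order compares \<open>emeasure\<close> as functions on all sets; off the
      sigma-algebra both values are 0.\<close>
    proof (cases "B \<in> sets M")
      case True
      then show ?thesis
        using le[of "A \<inter> B"] A
        by (simp add: emeasure_density nn_integral_indicator sets_eq
            flip: indicator_inter_arith)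
    qed (simp add: emeasure_notin_sets sets_eq)
  qed
  then have "(\<integral>\<^sup>+x. ennreal (f x) \<partial>density M (indicator A))
      \<le> (\<integral>\<^sup>+x. ennreal (f x) \<partial>density N (indicator A))"
    by (intro nn_integral_mono_measure) (simp_all add: sets_eq)
  then have *: "(\<integral>\<^sup>+x. ennreal (indicator A x * f x) \<partial>M) \<le> (\<integral>\<^sup>+x. ennreal (indicator A x * f x) \<partial>N)"
    by (simp add: nn_integral_density ennreal_mult' ennreal_indicator)
  have "integrable M (\<lambda>x. indicator A x * f x)" "integrable N (\<lambda>x. indicator A x * f x)"
    by (auto intro!: M.integrable_const_bound[of _ b] N.integrable_const_bound[of _ b]
        AE_I2 split: split_indicator simp: space_eq bnd) (use bnd in fastforce)+
  moreover from this have "ennreal (\<integral>x. indicator A x * f x \<partial>M) \<le> ennreal (\<integral>x. indicator A x * f x \<partial>N)"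
    using * by (subst (asm) (1 2) nn_integral_eq_integral) (auto simp: space_eq bnd intro!: AE_I2)
  ultimately show ?thesis
    by (subst (asm) ennreal_le_iff)
      (auto simp: space_eq bnd intro!: Bochner_Integration.integral_nonneg)
qed

text \<open>A real \<open>SUP\<close> is only known to dominate its members when the family is
  bounded above; here 1 is a bound.\<close>

lemma tv_dist_bound:
  assumes "prob_space M" "prob_space N" and A: "A \<in> sets M"
  shows "2 * \<bar>measure M A - measure N A\<bar> \<le> tv_dist M N"
proof -
  interpret M: prob_space M by fact
  interpret N: prob_space N by fact
  have "bdd_above ((\<lambda>B. \<bar>measure M B - measure N B\<bar>) ` sets M)"
  proof (rule bdd_aboveI2)
    show "\<bar>measure M B - measure N B\<bar> \<le> 1" for B
      using M.prob_le_1[of B] N.prob_le_1[of B] measure_nonneg[of M B] measure_nonneg[of N B]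
      by linarith
  qed
  from cSUP_upper[OF A this] show ?thesis
    by (simp add: tv_dist_def)
qed

lemma tv_dist_commute:
  assumes "sets M = sets N"
  shows "tv_dist M N = tv_dist N M"
  by (simp add: tv_dist_def assms abs_minus_commute)

text \<open>Let \<open>A\<close> be a Hahn set, on which \<open>M\<close> dominates
  \<open>N\<close>, with the reverse off \<open>A\<close>. Passing from \<open>M\<close> to
  \<open>N\<close> increases the integral of \<open>f\<close> off \<open>A\<close> and decreases
  that of \<open>b - f\<close> on \<open>A\<close>, so only \<open>b\<close> times the difference of
  the masses of \<open>A\<close> remains. Working with the range from 0 to \<open>b\<close> instead
  of a bound on the absolute value gains the factor 1/2.\<close>

lemma integral_diff_le_tv_dist:
  fixes f :: "'a \<Rightarrow> real"
  assumes "prob_space M" "prob_space N" and sets_eq: "sets N = sets M"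
    and f[measurable]: "f \<in> borel_measurable M"
    and bnd: "\<And>x. x \<in> space M \<Longrightarrow> 0 \<le> f x" "\<And>x. x \<in> space M \<Longrightarrow> f x \<le> b"
  shows "(\<integral>x. f x \<partial>M) - (\<integral>x. f x \<partial>N) \<le> b * (tv_dist M N / 2)"
proof -
  interpret M: prob_space M by fact
  interpret N: prob_space N by fact
  note [measurable_cong] = sets_eq
  have space_eq: "space N = space M" by (rule sets_eq_imp_space_eq[OF sets_eq])
  obtain x where "x \<in> space M" using M.not_empty by blast
  with bnd[of x] have b: "0 \<le> b" by linarith
  obtain A where A[measurable]: "A \<in> sets M"
    and in_A: "\<And>B. B \<in> sets M \<Longrightarrow> B \<subseteq> A \<Longrightarrow> emeasure N B \<le> emeasure M B"
    and off_A: "\<And>B. B \<in> sets M \<Longrightarrow> B \<inter> A = {} \<Longrightarrow> emeasure M B \<le> emeasure N B"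
    using finite_unsigned_Hahn_decomposition[OF M.finite_measure_axioms N.finite_measure_axioms sets_eq]
    by metis
  let ?A' = "space M - A"
  have int[simp]: "integrable M (\<lambda>x. indicator B x * g x)" "integrable N (\<lambda>x. indicator B x * g x)"
    if [measurable]: "B \<in> sets M" "g \<in> borel_measurable M"
      and "\<And>x. x \<in> space M \<Longrightarrow> 0 \<le> g x" "\<And>x. x \<in> space M \<Longrightarrow> g x \<le> b" for B g
    using that(3,4) b
    by (auto intro!: M.integrable_const_bound[of _ b] N.integrable_const_bound[of _ b]
        AE_I2 split: split_indicator simp: space_eq)
  \<comment> \<open>On \<open>A\<close> the function is rewritten as \<open>b - (b - f)\<close>, so
    that each non-constant integrand is nonnegative and the monotonicity lemma applies to
    it.\<close>
  have split: "(\<integral>x. f x \<partial>L) = (\<integral>x. indicator ?A' x * f x \<partial>L) + b * measure L A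
      - (\<integral>x. indicator A x * (b - f x) \<partial>L)"
    if "L = M \<or> L = N" for L
  proof -
    have L: "A \<in> sets L" "emeasure L A < \<infinity>"
      using that by (auto simp: sets_eq less_top[symmetric])
    have int_L: "integrable L (\<lambda>x. indicator ?A' x * f x)"
      "integrable L (\<lambda>x. indicator A x * (b - f x))"
      "integrable L (\<lambda>x. indicator A x * b)"
      using that b bnd L by auto
    have "(\<integral>x. f x \<partial>L)
        = (\<integral>x. indicator ?A' x * f x + indicator A x * b - indicator A x * (b - f x) \<partial>L)"
      using that by (intro Bochner_Integration.integral_cong) (auto simp: space_eq split: split_indicator)
    also have "\<dots> = (\<integral>x. indicator ?A' x * f x \<partial>L) + (\<integral>x. indicator A x * b \<partial>L)
      - (\<integral>x. indicator A x * (b - f x) \<partial>L)"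
      by (simp only: int_L Bochner_Integration.integral_diff Bochner_Integration.integral_add
          Bochner_Integration.integrable_add)
    also have "(\<integral>x. indicator A x * b \<partial>L) = b * measure L A"
      using sets.sets_into_space[OF L(1)] by (simp add: Int_absorb2)
    finally show ?thesis .
  qed
  have "(\<integral>x. indicator ?A' x * f x \<partial>M) \<le> (\<integral>x. indicator ?A' x * f x \<partial>N)"
    using off_A bnd
    by (intro integral_indicator_mono_measure[where b = b]
        M.finite_measure_axioms N.finite_measure_axioms sets_eq) auto
  moreover have "(\<integral>x. indicator A x * (b - f x) \<partial>N) \<le> (\<integral>x. indicator A x * (b - f x) \<partial>M)"
    using in_A bnd
    by (intro integral_indicator_mono_measure[where b = b]
        M.finite_measure_axioms N.finite_measure_axioms) (auto simp: sets_eq space_eq)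
  moreover have "b * measure M A - b * measure N A \<le> b * (tv_dist M N / 2)"
    unfolding right_diff_distrib[symmetric]
    using tv_dist_bound[OF assms(1,2) A] abs_ge_self[of "measure M A - measure N A"] b
    by (intro mult_left_mono) simp_all
  ultimately show ?thesis
    using split[of M] split[of N] by simp
qed

lemma abs_integral_diff_le_tv_dist:
  fixes f :: "'a \<Rightarrow> real"
  assumes "prob_space M" "prob_space N" and sets_eq: "sets N = sets M"
    and "f \<in> borel_measurable M"
    and "\<And>x. x \<in> space M \<Longrightarrow> 0 \<le> f x" "\<And>x. x \<in> space M \<Longrightarrow> f x \<le> b"
  shows "\<bar>(\<integral>x. f x \<partial>M) - (\<integral>x. f x \<partial>N)\<bar> \<le> b * (tv_dist M N / 2)"
proof -
  have "(\<integral>x. f x \<partial>N) - (\<integral>x. f x \<partial>M) \<le> b * (tv_dist N M / 2)"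
    using assms sets_eq_imp_space_eq[OF sets_eq] measurable_cong_sets[OF sets_eq refl]
    by (intro integral_diff_le_tv_dist) auto
  then show ?thesis
    using integral_diff_le_tv_dist[OF assms] tv_dist_commute[OF sets_eq]
    unfolding abs_le_iff by simp
qed

section \<open>Marginals and first-step decomposition of the Ionescu-Tulcea process\<close>

context Ionescu_Tulcea
begin

text \<open>\<open>CI J\<close> runs the chain for \<open>up_to J\<close> stages and then restricts
  to \<open>J\<close>; for an initial segment this identifies the number of stages.\<close>

lemma up_to_lessThan: "up_to {..<n} = n"
  using up_to_less[of "{..<n}" "up_to {..<n}"] up_to_iff[of "{..<n}" n] by fastforce

text \<open>Coordinate \<open>t\<close> factors through the restriction to the first
  \<open>Suc t\<close> coordinates, whose law under the limit is given by the finite chain.\<close>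

lemma nn_integral_lim_component:
  assumes [measurable]: "f \<in> borel_measurable (M t)"
  shows "(\<integral>\<^sup>+\<omega>. f (\<omega> t) \<partial>PF.lim) = (\<integral>\<^sup>+h. f (h t) \<partial>C 0 (Suc t) (\<lambda>_. undefined))"
proof -
  let ?J = "{..<Suc t}" let ?C = "C 0 (Suc t) (\<lambda>_. undefined)"
  have C[measurable_cong]: "sets ?C = sets (PiM ?J M)"
    using sets_C[of "\<lambda>_. undefined" 0 "Suc t"] by (simp add: lessThan_atLeast0 space_PiM)
  note [measurable_cong] = PF.sets_lim
  have [measurable]: "(\<lambda>h. h t) \<in> PiM ?J M \<rightarrow>\<^sub>M M t"
    by (rule measurable_component_singleton) simp
  have r: "(\<lambda>h. restrict h ?J) \<in> PiM UNIV M \<rightarrow>\<^sub>M PiM ?J M" "(\<lambda>h. restrict h ?J) \<in> PiM ?J M \<rightarrow>\<^sub>M PiM ?J M"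
    by (auto intro!: measurable_restrict_subset)
  have "(\<integral>\<^sup>+\<omega>. f (\<omega> t) \<partial>PF.lim) = (\<integral>\<^sup>+h. f (h t) \<partial>distr PF.lim (PiM ?J M) (\<lambda>h. restrict h ?J))"
    using r by (subst nn_integral_distr) auto
  \<comment> \<open>The restriction on the right stems from \<open>CI\<close>; evaluation at
    \<open>t\<close> does not see it, since \<open>t\<close> lies in \<open>?J\<close>.\<close>
  also have "distr PF.lim (PiM ?J M) (\<lambda>h. restrict h ?J) = distr ?C (PiM ?J M) (\<lambda>h. restrict h ?J)"
    by (subst distr_lim) (simp_all add: CI_def up_to_lessThan)
  also have "(\<integral>\<^sup>+h. f (h t) \<partial>\<dots>) = (\<integral>\<^sup>+h. f (h t) \<partial>?C)"
    using r by (subst nn_integral_distr) (auto simp: measurable_cong_sets[OF C refl] simp del: C.simps)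
  finally show ?thesis .
qed

text \<open>The recursion for \<open>C\<close> peels off the last stage, whereas a prior acts in the
  first, so the chain is split after one step by \<open>split_C\<close>. Here \<open>P\<close>
  denotes the kernels of the locale, not a prior.\<close>

lemma nn_integral_C_first_step:
  assumes [measurable]: "f \<in> borel_measurable (PiM {0..<Suc t} M)"
  shows "(\<integral>\<^sup>+h. f h \<partial>C 0 (Suc t) (\<lambda>_. undefined))
    = (\<integral>\<^sup>+z. \<integral>\<^sup>+h. f h \<partial>C 1 t ((\<lambda>_. undefined)(0 := z)) \<partial>P 0 (\<lambda>_. undefined))"
proof -
  let ?\<omega> = "\<lambda>_. undefined :: 'a"
  \<comment> \<open>The product over no coordinates has \<open>undefined\<close> as its only point:
    the empty history.\<close>
  have \<omega>[simp]: "?\<omega> \<in> space (PiM {0..<0} M)" by (simp add: space_PiM)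
  have "C 0 (Suc t) ?\<omega> = C 0 1 ?\<omega> \<bind> C (0 + 1) t"
    using split_C[OF \<omega>, of 1 t] by simp
  also have "C 0 1 ?\<omega> = eP 0 ?\<omega>"
    using bind_return[OF measurable_eP \<omega>] by simp
  finally have "C 0 (Suc t) ?\<omega> = eP 0 ?\<omega> \<bind> C 1 t" by simp
  moreover have m: "C 1 t \<in> PiM {0..<Suc 0} M \<rightarrow>\<^sub>M subprob_algebra (PiM {0..<Suc t} M)"
    using measurable_C[of 1 t] by simp
  moreover have "sets (eP 0 ?\<omega>) = sets (PiM {0..<Suc 0} M)"
    by (rule sets_eP[OF \<omega>])
  ultimately have "(\<integral>\<^sup>+h. f h \<partial>C 0 (Suc t) ?\<omega>) = (\<integral>\<^sup>+k. \<integral>\<^sup>+h. f h \<partial>C 1 t k \<partial>eP 0 ?\<omega>)"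
    by (simp add: nn_integral_bind[OF assms] cong: measurable_cong_sets)
  \<comment> \<open>\<open>eP\<close> is the image of the stage kernel under appending the new stage
    to the history.\<close>
  also have "\<dots> = (\<integral>\<^sup>+z. \<integral>\<^sup>+h. f h \<partial>C 1 t (?\<omega>(0 := z)) \<partial>P 0 ?\<omega>)"
    by (rule nn_integral_eP[OF \<omega>]) (use nn_integral_measurable_subprob_algebra2[OF _ m, of "\<lambda>_. f"] m in measurable)
  finally show ?thesis .
qed

end

section \<open>Isolating the prior in the initial stage\<close>

text \<open>This is \<open>stage_kernel\<close> at time 0 without the integration over the prior,
  which then appears only as an outer \<open>bind\<close>. The history is a placeholder, as
  \<open>info 0\<close> never reads it.\<close>

definition first_stage_kernel :: "'x::topological_space set \<Rightarrow> 'y::topological_space set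
    \<Rightarrow> 'u::topological_space set \<Rightarrow> ('x \<Rightarrow> 'y measure) \<Rightarrow> ('y, 'u) policy
    \<Rightarrow> 'x \<Rightarrow> ('x \<times> 'y \<times> 'u) measure" where
  "first_stage_kernel X Y U Q \<gamma> x =
    Q x \<bind> (\<lambda>y. return (stage_space X Y U) (x, y, \<gamma> 0 (info 0 (\<lambda>_. undefined :: 'x \<times> 'y \<times> 'u) y)))"

lemma stage_kernel_0:
  "stage_kernel X Y U T P Q \<gamma> 0 (\<lambda>_. undefined) = P \<bind> first_stage_kernel X Y U Q \<gamma>"
  by (simp add: stage_kernel_def state_kernel_def first_stage_kernel_def[abs_def])

lemma stage_kernel_Suc:
  "stage_kernel X Y U T P Q \<gamma> (Suc s) = stage_kernel X Y U T P' Q \<gamma> (Suc s)"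
  by (simp add: stage_kernel_def[abs_def] state_kernel_def)

lemma measurable_first_stage_kernel:
  fixes X :: "'x::topological_space set" and Y :: "'y::topological_space set"
    and U :: "'u::topological_space set"
  assumes Q: "Q \<in> borel_on X \<rightarrow>\<^sub>M prob_algebra (borel_on Y)" and \<gamma>: "\<gamma> \<in> policies Y U"
  shows "first_stage_kernel X Y U Q \<gamma> \<in> borel_on X \<rightarrow>\<^sub>M prob_algebra (stage_space X Y U)"
proof -
  let ?h = "\<lambda>_. undefined :: 'x \<times> 'y \<times> 'u"
  have g: "\<gamma> 0 \<in> info_space Y U 0 \<rightarrow>\<^sub>M borel_on U"
    using \<gamma> by (simp add: policies_def)
  have "(\<lambda>z. \<gamma> 0 (info 0 ?h (snd z))) \<in> borel_on X \<Otimes>\<^sub>M borel_on Y \<rightarrow>\<^sub>M borel_on U"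
    by (rule measurable_compose[OF measurable_info[where X = X and h = "\<lambda>_. ?h" and f = snd] g])
      (simp_all add: space_PiM)
  then have "(\<lambda>z. (fst z, snd z, \<gamma> 0 (info 0 ?h (snd z))))
      \<in> borel_on X \<Otimes>\<^sub>M borel_on Y \<rightarrow>\<^sub>M stage_space X Y U"
    unfolding stage_space_def by measurable
  then have "(\<lambda>(x, y). return (stage_space X Y U) (x, y, \<gamma> 0 (info 0 ?h y)))
      \<in> borel_on X \<Otimes>\<^sub>M borel_on Y \<rightarrow>\<^sub>M prob_algebra (stage_space X Y U)"
    using measurable_compose[OF _ measurable_return_prob_space] by (simp add: case_prod_beta')
  from measurable_bind_prob_space2[OF Q this] show ?thesis
    by (simp add: first_stage_kernel_def[abs_def])
qed

text \<open>\<open>C 1 t\<close> is composed of the kernels of stages 1 to \<open>t\<close>, whose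
  states are drawn from \<open>T\<close>.\<close>

lemma C_1_prior_independent:
  assumes "Ionescu_Tulcea (stage_kernel X Y U T P Q \<gamma>) (\<lambda>_. stage_space X Y U)"
    and "Ionescu_Tulcea (stage_kernel X Y U T P' Q \<gamma>) (\<lambda>_. stage_space X Y U)"
  shows "Ionescu_Tulcea.C (stage_kernel X Y U T P Q \<gamma>) (\<lambda>_. stage_space X Y U) 1 t h
    = Ionescu_Tulcea.C (stage_kernel X Y U T P' Q \<gamma>) (\<lambda>_. stage_space X Y U) 1 t h"
proof -
  interpret IT: Ionescu_Tulcea "stage_kernel X Y U T P Q \<gamma>" "\<lambda>_. stage_space X Y U" by fact
  interpret IT': Ionescu_Tulcea "stage_kernel X Y U T P' Q \<gamma>" "\<lambda>_. stage_space X Y U" by fact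
  have "IT.eP (Suc s) = IT'.eP (Suc s)" for s
    unfolding IT.eP_def[abs_def] IT'.eP_def[abs_def] stage_kernel_Suc[of X Y U T P Q \<gamma> s P'] ..
  then show ?thesis
    by (induction t) simp_all
qed

text \<open>
  The prior enters only the kernel of stage \<open>0\<close>, so the continuation after that stage can be taken
  from the process with an arbitrary reference prior \<open>P\<^sub>0\<close>.
\<close>

lemma process_law_disintegration:
  assumes Q: "Q \<in> borel_on X \<rightarrow>\<^sub>M prob_algebra (borel_on Y)"
    and T: "T \<in> borel_on X \<Otimes>\<^sub>M borel_on U \<rightarrow>\<^sub>M prob_algebra (borel_on X)"
    and \<gamma>: "\<gamma> \<in> policies Y U"
    and P\<^sub>0: "P\<^sub>0 \<in> prob_measures X"
    and f: "f \<in> borel_measurable (stage_space X Y U)"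
  obtains \<phi> where "\<phi> \<in> borel_measurable (borel_on X)"
    and "\<And>P. P \<in> prob_measures X \<Longrightarrow>
      (\<integral>\<^sup>+\<omega>. f (\<omega> t) \<partial>process_law X Y U T P Q \<gamma>) = (\<integral>\<^sup>+x. \<phi> x \<partial>P)"
proof -
  let ?S = "stage_space X Y U"
  let ?M = "\<lambda>_::nat. ?S"
  note IT = Ionescu_Tulcea_stage_kernel[OF _ Q T \<gamma>]
  interpret IT0: Ionescu_Tulcea "stage_kernel X Y U T P\<^sub>0 Q \<gamma>" ?M
    by (rule IT[OF P\<^sub>0])
  \<comment> \<open>\<open>\<psi>\<close> and \<open>\<phi>\<close> are the expectations of the
    time-\<open>t\<close> value given stage 0 and given the initial state, respectively. For
    \<open>t = 0\<close> the continuation is a point mass, so no case distinction arises.\<close>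
  define \<psi> where "\<psi> z = (\<integral>\<^sup>+h. f (h t) \<partial>IT0.C 1 t ((\<lambda>_. undefined)(0 := z)))" for z
  define \<phi> where "\<phi> x = (\<integral>\<^sup>+z. \<psi> z \<partial>first_stage_kernel X Y U Q \<gamma> x)" for x
  have N: "first_stage_kernel X Y U Q \<gamma> \<in> borel_on X \<rightarrow>\<^sub>M subprob_algebra ?S"
    by (rule measurable_prob_algebraD[OF measurable_first_stage_kernel[OF Q \<gamma>]])
  have ft: "(\<lambda>h. f (h t)) \<in> borel_measurable (PiM {0..<Suc t} ?M)"
    by (rule measurable_compose[OF _ f], rule measurable_component_singleton) simp
  have C: "IT0.C 1 t \<in> PiM {0..<Suc 0} ?M \<rightarrow>\<^sub>M subprob_algebra (PiM {0..<Suc t} ?M)"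
    using IT0.measurable_C[of 1 t] by simp
  have "(\<lambda>z. (\<lambda>_. undefined)(0 := z)) \<in> ?S \<rightarrow>\<^sub>M PiM {0..<Suc 0} ?M"
    by (rule measurable_fun_upd[where J = "{}"]) (auto simp: space_PiM)
  note measurable_compose[OF this measurable_compose[OF C nn_integral_measurable_subprob_algebra[OF ft]]]
  then have \<psi>: "\<psi> \<in> borel_measurable ?S"
    by (simp add: \<psi>_def[abs_def])
  have \<phi>: "\<phi> \<in> borel_measurable (borel_on X)"
    unfolding \<phi>_def[abs_def]
    by (rule measurable_compose[OF N nn_integral_measurable_subprob_algebra[OF \<psi>]])
  have "(\<integral>\<^sup>+\<omega>. f (\<omega> t) \<partial>process_law X Y U T P Q \<gamma>) = (\<integral>\<^sup>+x. \<phi> x \<partial>P)"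
    if P: "P \<in> prob_measures X" for P
  proof -
    interpret IT: Ionescu_Tulcea "stage_kernel X Y U T P Q \<gamma>" ?M
      by (rule IT[OF P])
    have "sets P = sets (borel_on X)"
      using P by (simp add: space_prob_algebra)
    then have N': "first_stage_kernel X Y U Q \<gamma> \<in> P \<rightarrow>\<^sub>M subprob_algebra ?S"
      using N by (simp cong: measurable_cong_sets)
    have "(\<integral>\<^sup>+\<omega>. f (\<omega> t) \<partial>process_law X Y U T P Q \<gamma>)
        = (\<integral>\<^sup>+h. f (h t) \<partial>IT.C 0 (Suc t) (\<lambda>_. undefined))"
      unfolding process_law_def by (rule IT.nn_integral_lim_component[OF f])
    \<comment> \<open>After stage 0 is split off, the continuation for \<open>P\<close> is exchanged
      for that of the reference prior.\<close>
    also have "\<dots> = (\<integral>\<^sup>+z. \<psi> z \<partial>(P \<bind> first_stage_kernel X Y U Q \<gamma>))"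
      unfolding IT.nn_integral_C_first_step[OF ft] stage_kernel_0 \<psi>_def
        C_1_prior_independent[OF IT[OF P] IT[OF P\<^sub>0]] ..
    also have "\<dots> = (\<integral>\<^sup>+x. \<phi> x \<partial>P)"
      unfolding \<phi>_def by (rule nn_integral_bind[OF \<psi> N'])
    finally show ?thesis .
  qed
  with \<phi> show thesis by (rule that)
qed

section \<open>Sensitivity of expected and discounted costs to the prior\<close>

lemma
  assumes "P \<in> prob_measures X"
    and "Q \<in> borel_on X \<rightarrow>\<^sub>M prob_algebra (borel_on Y)"
    and "T \<in> borel_on X \<Otimes>\<^sub>M borel_on U \<rightarrow>\<^sub>M prob_algebra (borel_on X)"
    and "\<gamma> \<in> policies Y U"
  shows prob_space_process_law: "prob_space (process_law X Y U T P Q \<gamma>)"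
    and sets_process_law: "sets (process_law X Y U T P Q \<gamma>) = sets (PiM UNIV (\<lambda>_. stage_space X Y U))"
proof -
  interpret IT: Ionescu_Tulcea "stage_kernel X Y U T P Q \<gamma>" "\<lambda>_. stage_space X Y U"
    by (rule Ionescu_Tulcea_stage_kernel[OF assms])
  show "sets (process_law X Y U T P Q \<gamma>) = sets (PiM UNIV (\<lambda>_. stage_space X Y U))"
    unfolding process_law_def by (rule IT.PF.sets_lim)
  \<comment> \<open>Images preserve total mass, so it suffices that the projection to no coordinates
    is a probability measure.\<close>
  have "prob_space (distr IT.PF.lim (PiM {} (\<lambda>_. stage_space X Y U)) (\<lambda>\<omega>. restrict \<omega> {}))"
    by (subst IT.distr_lim) (simp_all add: IT.PF.prob_space_P)
  then show "prob_space (process_law X Y U T P Q \<gamma>)"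
    unfolding process_law_def
    by (rule prob_space_distrD[rotated])
      (simp add: measurable_cong_sets[OF IT.PF.sets_lim refl] measurable_restrict_subset)
qed

text \<open>The disintegration yields one function \<open>\<phi>\<close> on the initial states that
  serves both priors, so the total variation estimate applies on \<open>X\<close>. Boundedness of
  \<open>\<phi>\<close> allows the return from extended to real values.\<close>

lemma expectation_prior_diff:
  fixes f :: "'x::topological_space \<times> 'y::topological_space \<times> 'u::topological_space \<Rightarrow> real"
  assumes Q: "Q \<in> borel_on X \<rightarrow>\<^sub>M prob_algebra (borel_on Y)"
    and T: "T \<in> borel_on X \<Otimes>\<^sub>M borel_on U \<rightarrow>\<^sub>M prob_algebra (borel_on X)"
    and \<gamma>: "\<gamma> \<in> policies Y U"
    and P: "P \<in> prob_measures X" and P': "P' \<in> prob_measures X"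
    and f: "f \<in> borel_measurable (stage_space X Y U)"
    and bnd: "\<And>z. z \<in> space (stage_space X Y U) \<Longrightarrow> 0 \<le> f z"
      "\<And>z. z \<in> space (stage_space X Y U) \<Longrightarrow> f z \<le> b"
  shows "\<bar>(\<integral>\<omega>. f (\<omega> t) \<partial>process_law X Y U T P Q \<gamma>) - (\<integral>\<omega>. f (\<omega> t) \<partial>process_law X Y U T P' Q \<gamma>)\<bar>
    \<le> b * (tv_dist P P' / 2)"
proof -
  let ?S = "stage_space X Y U"
  let ?L = "\<lambda>P. process_law X Y U T P Q \<gamma>"
  obtain \<phi> where \<phi>: "\<phi> \<in> borel_measurable (borel_on X)"
    and eq: "\<And>P. P \<in> prob_measures X \<Longrightarrow> (\<integral>\<^sup>+\<omega>. ennreal (f (\<omega> t)) \<partial>?L P) = (\<integral>\<^sup>+x. \<phi> x \<partial>P)"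
    using process_law_disintegration[OF Q T \<gamma> P, of "\<lambda>z. ennreal (f z)" t] f by auto
  have comp: "\<omega> t \<in> space ?S" if "\<omega> \<in> space (?L R)" "R \<in> prob_measures X" for \<omega> R
    using that sets_eq_imp_space_eq[OF sets_process_law[OF _ Q T \<gamma>]] by (auto simp: space_PiM)
  have ft: "(\<lambda>\<omega>. f (\<omega> t)) \<in> borel_measurable (?L R)" if "R \<in> prob_measures X" for R
    unfolding measurable_cong_sets[OF sets_process_law[OF that Q T \<gamma>] refl]
    by (rule measurable_compose[OF _ f], rule measurable_component_singleton) simp
  \<comment> \<open>The bound on \<open>f\<close> passes to \<open>\<phi>\<close> by starting the process in \<open>x\<close>.\<close>
  have \<phi>_le: "\<phi> x \<le> ennreal b" if x: "x \<in> X" for x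
  proof -
    let ?R = "return (borel_on X) x"
    have R: "?R \<in> prob_measures X"
      using x by (simp add: space_prob_algebra prob_space_return space_restrict_space)
    interpret prob_space "?L ?R"
      by (rule prob_space_process_law[OF R Q T \<gamma>])
    have "\<phi> x = (\<integral>\<^sup>+x. \<phi> x \<partial>?R)"
      using x \<phi> by (simp add: nn_integral_return space_restrict_space)
    also have "\<dots> = (\<integral>\<^sup>+\<omega>. ennreal (f (\<omega> t)) \<partial>?L ?R)"
      by (rule eq[OF R, symmetric])
    also have "\<dots> \<le> (\<integral>\<^sup>+\<omega>. ennreal b \<partial>?L ?R)"
      by (intro nn_integral_mono ennreal_leI bnd comp[OF _ R])
    finally show ?thesis
      by (simp add: emeasure_space_1)
  qed
  have fin: "\<phi> x < top" if "x \<in> X" for x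
    using \<phi>_le[OF that] by (simp add: le_less_trans)
  have int: "(\<integral>\<omega>. f (\<omega> t) \<partial>?L R) = (\<integral>x. enn2real (\<phi> x) \<partial>R)" if R: "R \<in> prob_measures X" for R
  proof -
    have sets: "sets R = sets (borel_on X)" using R by (simp add: space_prob_algebra)
    have "(\<integral>\<omega>. f (\<omega> t) \<partial>?L R) = enn2real (\<integral>\<^sup>+x. \<phi> x \<partial>R)"
      using ft[OF R] comp[OF _ R] by (subst integral_eq_nn_integral) (auto simp: eq[OF R] bnd)
    also have "(\<integral>\<^sup>+x. \<phi> x \<partial>R) = (\<integral>\<^sup>+x. ennreal (enn2real (\<phi> x)) \<partial>R)"
      using sets_eq_imp_space_eq[OF sets] by (intro nn_integral_cong) (simp add: fin space_restrict_space)
    also have "enn2real \<dots> = (\<integral>x. enn2real (\<phi> x) \<partial>R)"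
      using \<phi> by (subst integral_eq_nn_integral) (auto simp: measurable_cong_sets[OF sets refl])
    finally show ?thesis .
  qed
  have "\<bar>(\<integral>x. enn2real (\<phi> x) \<partial>P) - (\<integral>x. enn2real (\<phi> x) \<partial>P')\<bar> \<le> b * (tv_dist P P' / 2)"
  proof (rule abs_integral_diff_le_tv_dist)
    have sets: "sets P = sets (borel_on X)" "sets P' = sets (borel_on X)"
      using P P' by (simp_all add: space_prob_algebra)
    then show "sets P' = sets P" by simp
    show "prob_space P" "prob_space P'"
      using P P' by (simp_all add: space_prob_algebra)
    show "(\<lambda>x. enn2real (\<phi> x)) \<in> borel_measurable P"
      using \<phi> by (simp add: measurable_cong_sets[OF sets(1) refl])
    fix x assume "x \<in> space P"
    then have x: "x \<in> X" using sets_eq_imp_space_eq[OF sets(1)] by (simp add: space_restrict_space)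
    \<comment> \<open>Some point of the stage space is needed to infer \<open>0 \<le> b\<close>; a
      probability measure on trajectories provides one.\<close>
    have "\<exists>z. z \<in> space ?S"
      using prob_space.not_empty[OF prob_space_process_law[OF P Q T \<gamma>]] comp[OF _ P] by blast
    then have "0 \<le> b" using bnd order_trans by blast
    then show "enn2real (\<phi> x) \<le> b" using \<phi>_le[OF x] enn2real_leI by blast
  qed simp
  then show ?thesis by (simp add: int P P')
qed

text \<open>Integrating the discounted series term by term turns \<open>J\<close> into a series of
  stage expectations. Their differences have a common bound, and the weights sum to
  \<open>1 / (1 - \<beta>)\<close>. Nonnegativity will bound the infimum over policies from
  below.\<close>

lemma
  fixes X :: "'x::topological_space set" and Y :: "'y::topological_space set"
    and U :: "'u::topological_space set"
  assumes Q: "Q \<in> borel_on X \<rightarrow>\<^sub>M prob_algebra (borel_on Y)"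
    and T: "T \<in> borel_on X \<Otimes>\<^sub>M borel_on U \<rightarrow>\<^sub>M prob_algebra (borel_on X)"
    and \<beta>: "0 \<le> \<beta>" "\<beta> < 1"
    and c: "c \<in> borel_measurable (borel_on X \<Otimes>\<^sub>M borel_on U)"
    and bnd: "\<And>z. z \<in> X \<times> U \<Longrightarrow> 0 \<le> c z" "\<And>z. z \<in> X \<times> U \<Longrightarrow> c z \<le> b"
    and \<gamma>: "\<gamma> \<in> policies Y U"
    and P: "P \<in> prob_measures X"
  shows J_nonneg: "0 \<le> J X Y U T c \<beta> P Q \<gamma>"
    and J_prior_diff: "P' \<in> prob_measures X \<Longrightarrow>
      \<bar>J X Y U T c \<beta> P Q \<gamma> - J X Y U T c \<beta> P' Q \<gamma>\<bar> \<le> b / (1 - \<beta>) * (tv_dist P P' / 2)"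
proof -
  let ?S = "stage_space X Y U"
  let ?L = "\<lambda>P. process_law X Y U T P Q \<gamma>"
  let ?f = "\<lambda>z. c (fst z, snd (snd z))"
  let ?a = "\<lambda>P t. \<integral>\<omega>. ?f (\<omega> t) \<partial>?L P"
  have f: "?f \<in> borel_measurable ?S"
    unfolding stage_space_def by (rule measurable_compose[OF _ c]) measurable
  have f_bnd: "0 \<le> ?f z" "?f z \<le> b" if "z \<in> space ?S" for z
    using that by (auto simp: stage_space_def space_pair_measure space_restrict_space intro!: bnd)
  have sums: "(\<lambda>t. \<beta> ^ t * ?a R t) sums J X Y U T c \<beta> R Q \<gamma>"
    and nonneg: "0 \<le> J X Y U T c \<beta> R Q \<gamma>" if R: "R \<in> prob_measures X" for R
  proof -
    interpret prob_space "?L R"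
      by (rule prob_space_process_law[OF R Q T \<gamma>])
    have comp: "\<omega> t \<in> space ?S" if "\<omega> \<in> space (?L R)" for \<omega> t
      using that sets_eq_imp_space_eq[OF sets_process_law[OF R Q T \<gamma>]] by (auto simp: space_PiM)
    have ft: "(\<lambda>\<omega>. ?f (\<omega> t)) \<in> borel_measurable (?L R)" for t
      unfolding measurable_cong_sets[OF sets_process_law[OF R Q T \<gamma>] refl]
      by (rule measurable_compose[OF _ f], rule measurable_component_singleton) simp
    have int: "integrable (?L R) (\<lambda>\<omega>. ?f (\<omega> t))" for t
      using ft f_bnd[OF comp] by (intro integrable_const_bound[of _ b] AE_I2) auto
    have le_b: "?a R t \<le> b" for t
      using integral_mono[OF int[of t], of "\<lambda>_. b"] f_bnd[OF comp] prob_space by simp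
    \<comment> \<open>A common majorant for the pathwise series and the series of
      expectations.\<close>
    have summ: "summable (\<lambda>t. \<beta> ^ t * b)"
      using \<beta> by (intro summable_mult2 summable_geometric) simp
    have pw: "summable (\<lambda>t. \<beta> ^ t * ?f (\<omega> t))" if "\<omega> \<in> space (?L R)" for \<omega>
      using f_bnd[OF comp[OF that]] \<beta>
      by (intro summable_comparison_test'[OF summ, of 0]) (auto simp: abs_mult intro!: mult_left_mono)
    show "(\<lambda>t. \<beta> ^ t * ?a R t) sums J X Y U T c \<beta> R Q \<gamma>"
    proof -
      have "(\<lambda>t. \<integral>\<omega>. \<beta> ^ t * ?f (\<omega> t) \<partial>?L R) sums (\<integral>\<omega>. (\<Sum>t. \<beta> ^ t * ?f (\<omega> t)) \<partial>?L R)"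
      proof (rule sums_integral)
        show "integrable (?L R) (\<lambda>\<omega>. \<beta> ^ t * ?f (\<omega> t))" for t
          using int by simp
        show "AE \<omega> in ?L R. summable (\<lambda>t. norm (\<beta> ^ t * ?f (\<omega> t)))"
          using pw f_bnd[OF comp] \<beta> by (intro AE_I2) (simp add: abs_mult)
        have "(\<integral>\<omega>. norm (\<beta> ^ t * ?f (\<omega> t)) \<partial>?L R) = \<beta> ^ t * ?a R t" for t
        proof -
          have "(\<integral>\<omega>. norm (\<beta> ^ t * ?f (\<omega> t)) \<partial>?L R) = (\<integral>\<omega>. \<beta> ^ t * ?f (\<omega> t) \<partial>?L R)"
            using f_bnd[OF comp] \<beta> by (intro Bochner_Integration.integral_cong) (auto simp: abs_mult)
          then show ?thesis by simp
        qed
        moreover have "summable (\<lambda>t. \<beta> ^ t * ?a R t)"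
          using le_b f_bnd[OF comp] \<beta>
          by (intro summable_comparison_test'[OF summ, of 0])
            (auto simp: abs_mult intro!: mult_left_mono Bochner_Integration.integral_nonneg)
        ultimately show "summable (\<lambda>t. \<integral>\<omega>. norm (\<beta> ^ t * ?f (\<omega> t)) \<partial>?L R)"
          by simp
      qed
      then show ?thesis by (simp add: J_def)
    qed
    show "0 \<le> J X Y U T c \<beta> R Q \<gamma>"
      unfolding J_def using pw f_bnd[OF comp] \<beta>
      by (intro Bochner_Integration.integral_nonneg suminf_nonneg) auto
  qed
  show "0 \<le> J X Y U T c \<beta> P Q \<gamma>" by (rule nonneg[OF P])
  assume P': "P' \<in> prob_measures X"
  let ?d = "b * (tv_dist P P' / 2)"
  have diff: "(\<lambda>t. \<beta> ^ t * (?a P t - ?a P' t)) sums (J X Y U T c \<beta> P Q \<gamma> - J X Y U T c \<beta> P' Q \<gamma>)"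
    using sums_diff[OF sums[OF P] sums[OF P']] by (simp add: right_diff_distrib)
  have geo: "(\<lambda>t. \<beta> ^ t * ?d) sums (1 / (1 - \<beta>) * ?d)"
    using \<beta> by (intro sums_mult2 geometric_sums) simp
  have "\<bar>?a P t - ?a P' t\<bar> \<le> ?d" for t
    by (rule expectation_prior_diff[OF Q T \<gamma> P P' f f_bnd])
  then have le: "norm (\<beta> ^ t * (?a P t - ?a P' t)) \<le> \<beta> ^ t * ?d" for t
    using \<beta> mult_left_mono[of _ ?d "\<beta> ^ t"] by (simp only: real_norm_def abs_mult power_abs) simp
  have "norm (\<Sum>t. \<beta> ^ t * (?a P t - ?a P' t)) \<le> (\<Sum>t. \<beta> ^ t * ?d)"
    by (rule norm_suminf_le[OF le sums_summable[OF geo]])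
  then show "\<bar>J X Y U T c \<beta> P Q \<gamma> - J X Y U T c \<beta> P' Q \<gamma>\<bar> \<le> b / (1 - \<beta>) * (tv_dist P P' / 2)"
    using sums_unique[OF diff] sums_unique[OF geo] by simp
qed

section \<open>Robustness of optimal policies to a misspecified prior\<close>

theorem theorem3p2:
  fixes X :: "'x::euclidean_space set" and Y :: "'y::euclidean_space set"
    and U :: "'u::euclidean_space set"
    and Q :: "'x \<Rightarrow> 'y measure" and T :: "'x \<times> 'u \<Rightarrow> 'x measure"
    and c :: "'x \<times> 'u \<Rightarrow> real" and \<beta> :: real
    and P P\<^sub>n :: "'x measure" and \<gamma>\<^sub>n :: "('y, 'u) policy"
  assumes "X \<in> sets borel" and "Y \<in> sets borel" and "U \<in> sets borel"
    and "Q \<in> borel_on X \<rightarrow>\<^sub>M prob_algebra (borel_on Y)"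
    and "T \<in> borel_on X \<Otimes>\<^sub>M borel_on U \<rightarrow>\<^sub>M prob_algebra (borel_on X)"
    and "0 < \<beta>" and "\<beta> < 1"
    and "c \<in> borel_measurable (borel_on X \<Otimes>\<^sub>M borel_on U)"
    and "\<forall>z\<in>X \<times> U. 0 \<le> c z" and "bounded (c ` (X \<times> U))"
    and "P\<^sub>n \<in> prob_measures X" and "P \<in> prob_measures X"
    and "\<gamma>\<^sub>n \<in> policies Y U"
    and "J X Y U T c \<beta> P\<^sub>n Q \<gamma>\<^sub>n = J_opt X Y U T c \<beta> P\<^sub>n Q"
  shows "\<bar>J X Y U T c \<beta> P Q \<gamma>\<^sub>n - J_opt X Y U T c \<beta> P Q\<bar>
    \<le> 2 * tv_dist P\<^sub>n P * (1 / (1 - \<beta>)) * sup_norm_on (X \<times> U) c"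
proof -
  note Q = assms(4) and T = assms(5) and c = assms(8) and P\<^sub>n = assms(11) and P = assms(12)
    and \<gamma>\<^sub>n = assms(13) and opt = assms(14)
  let ?J = "J X Y U T c \<beta>" and ?b = "sup_norm_on (X \<times> U) c"
  let ?e = "?b / (1 - \<beta>) * (tv_dist P\<^sub>n P / 2)"
  have c0: "0 \<le> c z" if "z \<in> X \<times> U" for z
    using assms(9) that by blast
  have "bdd_above ((\<lambda>z. \<bar>c z\<bar>) ` (X \<times> U))"
    using assms(10) unfolding bounded_iff by (auto simp: bdd_above_def)
  then have cb: "c z \<le> ?b" if "z \<in> X \<times> U" for z
    unfolding sup_norm_on_def using cSUP_upper[OF that] by (metis abs_ge_self order_trans)
  have \<beta>: "0 \<le> \<beta>" "\<beta> < 1" using assms by auto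
  have diff: "\<bar>?J P\<^sub>n Q \<gamma> - ?J P Q \<gamma>\<bar> \<le> ?e" if "\<gamma> \<in> policies Y U" for \<gamma>
    by (rule J_prior_diff[OF Q T \<beta> c c0 cb that P\<^sub>n P])
  \<comment> \<open>A real \<open>INF\<close> is known to lie below its members only for a family
    bounded below.\<close>
  have bdd: "bdd_below (?J R Q ` policies Y U)" if "R \<in> prob_measures X" for R
    using J_nonneg[OF Q T \<beta> c c0 cb _ that] by (intro bdd_belowI2[of _ 0])
  \<comment> \<open>For each competitor \<open>\<gamma>\<close>, one \<open>?e\<close> pays for
    moving \<open>\<gamma>\<^sub>n\<close> from \<open>P\<close> to \<open>P\<^sub>n\<close>,
    optimality replaces it there by \<open>\<gamma>\<close>, and a second \<open>?e\<close> pays for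
    moving \<open>\<gamma>\<close> back to \<open>P\<close>.\<close>
  have "?J P Q \<gamma>\<^sub>n - 2 * ?e \<le> J_opt X Y U T c \<beta> P Q"
    unfolding J_opt_def
  proof (rule cINF_greatest)
    fix \<gamma> assume \<gamma>: "\<gamma> \<in> policies Y U"
    have "?J P\<^sub>n Q \<gamma>\<^sub>n \<le> ?J P\<^sub>n Q \<gamma>"
      unfolding opt J_opt_def by (rule cINF_lower[OF bdd[OF P\<^sub>n] \<gamma>])
    then show "?J P Q \<gamma>\<^sub>n - 2 * ?e \<le> ?J P Q \<gamma>"
      using diff[OF \<gamma>] diff[OF \<gamma>\<^sub>n] by linarith
  qed (use \<gamma>\<^sub>n in blast)
  moreover have "J_opt X Y U T c \<beta> P Q \<le> ?J P Q \<gamma>\<^sub>n"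
    unfolding J_opt_def by (rule cINF_lower[OF bdd[OF P] \<gamma>\<^sub>n])
  moreover have "0 \<le> ?e" using diff[OF \<gamma>\<^sub>n] by linarith
  \<comment> \<open>The claimed bound equals \<open>4 * ?e\<close>, so the estimate by
    \<open>2 * ?e\<close> leaves a factor 2 to spare, and \<open>0 \<le> ?e\<close> allows the
    weakening.\<close>
  moreover have "2 * tv_dist P\<^sub>n P * (1 / (1 - \<beta>)) * ?b = 4 * ?e"
    using \<beta> by (simp add: field_simps)
  ultimately show ?thesis by linarith
qed

end
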